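(* For every $\gamma \in [0,1]$, the contraction $M^{\omega}_{\gamma} = M_{\gamma} \cap C^{\omega}[0,1] = \{ f \in C^{\omega}[0,1] \mid f(\gamma) = 0 \}$ of $M_\gamma$ under the inclusion $C^{\omega}[0,1] \subset C[0,1]$ is a maximal ideal of $C^{\omega}[0,1]$. Conversely, every maximal ideal of $C^{\omega}[0,1]$ is equal to $M^{\omega}_{\gamma}$ for some $\gamma \in [0,1]$.
   Context: $C[0,1]$ is the ring (pointwise operations) of real-valued continuous functions on $[0,1]$. $C^{\omega}[0,1]$ is its subring of real analytic functions $f:[0,1]\to\mathbb{R}$, i.e. functions such that for each $a \in [0,1]$ there is a real power series centered at $a$ that converges to $f(x)$ for all $x$ in some relatively open neighborhood of $a$ in $[0,1]$ (one-sided at the endpoints). For $\gamma \in [0,1]$, $M_{\gamma} = \{ f \in C[0,1] \mid f(\gamma) = 0 \}$. *)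

theory Defs
  imports "HOL-Analysis.Analysis" "HOL-Algebra.Ideal" "HOL-Algebra.Subrings"
begin

text \<open>
  Functions on \<open>[0,1]\<close> are total functions \<open>real \<Rightarrow> real\<close> that are \<^const>\<open>extensional\<close>
  on \<open>{0..1}\<close>, so that equality of ring elements is equality of functions on \<open>[0,1]\<close>.
\<close>

definition C01 :: "(real \<Rightarrow> real) ring" where
  "C01 =
    \<lparr>carrier = {f \<in> extensional {0..1}. continuous_on {0..1} f},
     mult = (\<lambda>f g. \<lambda>x\<in>{0..1}. f x * g x),
     one = (\<lambda>x\<in>{0..1}. 1),
     zero = (\<lambda>x\<in>{0..1}. 0),
     add = (\<lambda>f g. \<lambda>x\<in>{0..1}. f x + g x)\<rparr>"

text \<open>
  The neighbourhood \<open>U\<close> is open relative to \<open>S\<close>, hence one-sided at an endpoint of an interval.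
\<close>

definition real_analytic_on :: "(real \<Rightarrow> real) \<Rightarrow> real set \<Rightarrow> bool" where
  "real_analytic_on f S \<longleftrightarrow>
    (\<forall>a\<in>S. \<exists>c U. openin (top_of_set S) U \<and> a \<in> U \<and>
       (\<forall>x\<in>U. (\<lambda>n. c n * (x - a) ^ n) sums f x))"

definition C_omega01 :: "(real \<Rightarrow> real) ring" where
  "C_omega01 = C01\<lparr>carrier := {f \<in> extensional {0..1}. real_analytic_on f {0..1}}\<rparr>"

definition M_C01 :: "real \<Rightarrow> (real \<Rightarrow> real) set" where
  "M_C01 \<gamma> = {f \<in> carrier C01. f \<gamma> = 0}"

definition M_omega :: "real \<Rightarrow> (real \<Rightarrow> real) set" where
  "M_omega \<gamma> = M_C01 \<gamma> \<inter> carrier C_omega01"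

lemma C01_simps:
  "f \<in> carrier C01 \<longleftrightarrow> f \<in> extensional {0..1} \<and> continuous_on {0..1} f"
  "f \<otimes>\<^bsub>C01\<^esub> g = (\<lambda>x\<in>{0..1}. f x * g x)"
  "f \<oplus>\<^bsub>C01\<^esub> g = (\<lambda>x\<in>{0..1}. f x + g x)"
  "\<one>\<^bsub>C01\<^esub> = (\<lambda>x\<in>{0..1}. 1)"
  "\<zero>\<^bsub>C01\<^esub> = (\<lambda>x\<in>{0..1}. 0)"
  by (simp_all add: C01_def)

lemma restrict_in_C01:
  assumes "continuous_on {0..1} f"
  shows "restrict f {0..1} \<in> carrier C01"
  unfolding C01_simps
proof
  show "continuous_on {0..1} (restrict f {0..1})"
    using assms by (rule continuous_on_eq) auto
qed (rule restrict_extensional)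

lemma cring_C01: "cring C01"
proof (rule cringI)
  have add: "f \<oplus>\<^bsub>C01\<^esub> g \<in> carrier C01" if "f \<in> carrier C01" "g \<in> carrier C01" for f g
    using that unfolding C01_simps(3)
    by (intro restrict_in_C01 continuous_on_add) (simp_all add: C01_simps(1))
  have mult: "f \<otimes>\<^bsub>C01\<^esub> g \<in> carrier C01" if "f \<in> carrier C01" "g \<in> carrier C01" for f g
    using that unfolding C01_simps(2)
    by (intro restrict_in_C01 continuous_on_mult) (simp_all add: C01_simps(1))
  have zero_one: "\<zero>\<^bsub>C01\<^esub> \<in> carrier C01" "\<one>\<^bsub>C01\<^esub> \<in> carrier C01"
    unfolding C01_simps(4,5) by (intro restrict_in_C01 continuous_on_const)+
  show "abelian_group C01"
  proof (rule abelian_groupI)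
    fix f assume f: "f \<in> carrier C01"
    have "(\<lambda>x\<in>{0..1}. - f x) \<in> carrier C01"
      using f by (intro restrict_in_C01 continuous_on_minus) (simp add: C01_simps(1))
    moreover have "(\<lambda>x\<in>{0..1}. - f x) \<oplus>\<^bsub>C01\<^esub> f = \<zero>\<^bsub>C01\<^esub>"
      by (auto simp: C01_simps fun_eq_iff)
    ultimately show "\<exists>g\<in>carrier C01. g \<oplus>\<^bsub>C01\<^esub> f = \<zero>\<^bsub>C01\<^esub>" by blast
  qed (use add zero_one in \<open>auto simp: C01_simps(2-) fun_eq_iff\<close>,
      auto simp: C01_simps(1) extensional_def)
  show "comm_monoid C01"
    by (rule comm_monoidI)
      (use mult zero_one in \<open>auto simp: C01_simps(2-) fun_eq_iff\<close>,
       auto simp: C01_simps(1) extensional_def)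
qed (auto simp: C01_simps(2-) fun_eq_iff algebra_simps)

lemma power_series_at_01:
  assumes "real_analytic_on f {0..1}" "a \<in> {0..1}"
  obtains c r where "r > 0" "\<And>x. x \<in> {0..1} \<Longrightarrow> \<bar>x - a\<bar> < r \<Longrightarrow> (\<lambda>n. c n * (x - a) ^ n) sums f x"
    "\<And>y. \<bar>y\<bar> < r \<Longrightarrow> summable (\<lambda>n. norm (c n * y ^ n))"
proof -
  obtain c U where U: "openin (top_of_set {0..1}) U" "a \<in> U"
    and s: "\<And>x. x \<in> U \<Longrightarrow> (\<lambda>n. c n * (x - a) ^ n) sums f x"
    using bspec[OF assms(1)[unfolded real_analytic_on_def] assms(2)] by blast
  obtain e where e: "e > 0" and eU: "\<And>x. x \<in> {0..1} \<Longrightarrow> \<bar>x - a\<bar> < e \<Longrightarrow> x \<in> U"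
    using U unfolding openin_euclidean_subtopology_iff dist_real_def by blast
  define r where "r = min (e/2) (1/2)"
  define b where "b = (if a \<le> 1/2 then a + r else a - r)"
  have b: "b \<in> {0..1}" "\<bar>b - a\<bar> = r" "r > 0" "r < e"
    using assms(2) e by (auto simp: b_def r_def)
  then have sb: "summable (\<lambda>n. c n * (b - a) ^ n)"
    by (intro sums_summable[OF s[OF eU]]) simp_all
  show ?thesis
  proof (rule that[of r c])
    fix y :: real assume "\<bar>y\<bar> < r"
    then show "summable (\<lambda>n. norm (c n * y ^ n))"
      using powser_insidea[OF sb, of y] b by simp
  next
    fix x assume "x \<in> {0..1}" "\<bar>x - a\<bar> < r"
    then show "(\<lambda>n. c n * (x - a) ^ n) sums f x"
      using b(4) by (intro s eU) simp_all
  qed (fact b(3))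
qed

lemma real_analytic_on_01I:
  assumes "\<And>a. a \<in> {0..1} \<Longrightarrow> \<exists>c r. r > 0 \<and>
    (\<forall>x\<in>{0..1}. \<bar>x - a\<bar> < r \<longrightarrow> (\<lambda>n. c n * (x - a) ^ n) sums f x)"
  shows "real_analytic_on f {0..1}"
  unfolding real_analytic_on_def
proof
  fix a :: real assume a: "a \<in> {0..1}"
  then obtain c r where "r > 0"
    and s: "\<forall>x\<in>{0..1}. \<bar>x - a\<bar> < r \<longrightarrow> (\<lambda>n. c n * (x - a) ^ n) sums f x"
    using assms by blast
  then show "\<exists>c U. openin (top_of_set {0..1}) U \<and> a \<in> U \<and> (\<forall>x\<in>U. (\<lambda>n. c n * (x - a) ^ n) sums f x)"
    using a by (intro exI[of _ c] exI[of _ "{0..1} \<inter> ball a r"])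
      (auto simp: openin_open_Int dist_real_def abs_minus_commute)
qed

lemma real_analytic_on_01_add:
  assumes "real_analytic_on f {0..1}" "real_analytic_on g {0..1}"
  shows "real_analytic_on (\<lambda>x\<in>{0..1}. f x + g x) {0..1}"
proof (rule real_analytic_on_01I)
  fix a :: real assume a: "a \<in> {0..1}"
  obtain c r where c: "r > 0" "\<And>x. x \<in> {0..1} \<Longrightarrow> \<bar>x - a\<bar> < r \<Longrightarrow> (\<lambda>n. c n * (x - a) ^ n) sums f x"
    by (rule power_series_at_01[OF assms(1) a]) (rule that; assumption)
  obtain d s where d: "s > 0" "\<And>x. x \<in> {0..1} \<Longrightarrow> \<bar>x - a\<bar> < s \<Longrightarrow> (\<lambda>n. d n * (x - a) ^ n) sums g x"
    by (rule power_series_at_01[OF assms(2) a]) (rule that; assumption)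
  show "\<exists>c r. r > 0 \<and> (\<forall>x\<in>{0..1}. \<bar>x - a\<bar> < r \<longrightarrow>
      (\<lambda>n. c n * (x - a) ^ n) sums (\<lambda>x\<in>{0..1}. f x + g x) x)"
    using c d sums_add[OF c(2) d(2)]
    by (intro exI[of _ "\<lambda>n. c n + d n"] exI[of _ "min r s"]) (auto simp: distrib_right)
qed

lemma real_analytic_on_01_mult:
  assumes "real_analytic_on f {0..1}" "real_analytic_on g {0..1}"
  shows "real_analytic_on (\<lambda>x\<in>{0..1}. f x * g x) {0..1}"
proof (rule real_analytic_on_01I)
  fix a :: real assume a: "a \<in> {0..1}"
  obtain c r where c: "r > 0" "\<And>x. x \<in> {0..1} \<Longrightarrow> \<bar>x - a\<bar> < r \<Longrightarrow> (\<lambda>n. c n * (x - a) ^ n) sums f x"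
    "\<And>y. \<bar>y\<bar> < r \<Longrightarrow> summable (\<lambda>n. norm (c n * y ^ n))"
    by (rule power_series_at_01[OF assms(1) a]) (rule that; assumption)
  obtain d s where d: "s > 0" "\<And>x. x \<in> {0..1} \<Longrightarrow> \<bar>x - a\<bar> < s \<Longrightarrow> (\<lambda>n. d n * (x - a) ^ n) sums g x"
    "\<And>y. \<bar>y\<bar> < s \<Longrightarrow> summable (\<lambda>n. norm (d n * y ^ n))"
    by (rule power_series_at_01[OF assms(2) a]) (rule that; assumption)
  have "(\<lambda>n. (\<Sum>i\<le>n. c i * d (n - i)) * (x - a) ^ n) sums (f x * g x)"
    if x: "x \<in> {0..1}" "\<bar>x - a\<bar> < r" "\<bar>x - a\<bar> < s" for x
  proof -
    have "(\<lambda>n. \<Sum>i\<le>n. (c i * (x - a) ^ i) * (d (n - i) * (x - a) ^ (n - i))) sums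
        ((\<Sum>n. c n * (x - a) ^ n) * (\<Sum>n. d n * (x - a) ^ n))"
      using c(3) d(3) x by (intro Cauchy_product_sums) auto
    moreover have "(\<Sum>i\<le>n. (c i * (x - a) ^ i) * (d (n - i) * (x - a) ^ (n - i))) =
        (\<Sum>i\<le>n. c i * d (n - i)) * (x - a) ^ n" for n
      unfolding sum_distrib_right
    proof (rule sum.cong[OF refl])
      fix i assume "i \<in> {..n}"
      then have "(x - a) ^ n = (x - a) ^ i * (x - a) ^ (n - i)"
        by (simp flip: power_add)
      then show "(c i * (x - a) ^ i) * (d (n - i) * (x - a) ^ (n - i)) = c i * d (n - i) * (x - a) ^ n"
        by simp
    qed
    moreover have "(\<Sum>n. c n * (x - a) ^ n) = f x" "(\<Sum>n. d n * (x - a) ^ n) = g x"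
      using sums_unique[OF c(2)] sums_unique[OF d(2)] x by simp_all
    ultimately show ?thesis by simp
  qed
  then show "\<exists>c r. r > 0 \<and> (\<forall>x\<in>{0..1}. \<bar>x - a\<bar> < r \<longrightarrow>
      (\<lambda>n. c n * (x - a) ^ n) sums (\<lambda>x\<in>{0..1}. f x * g x) x)"
    using c(1) d(1)
    by (intro exI[of _ "\<lambda>n. \<Sum>i\<le>n. c i * d (n - i)"] exI[of _ "min r s"]) auto
qed

lemma real_analytic_on_01_const: "real_analytic_on (\<lambda>x\<in>{0..1}. k) {0..1}"
proof (rule real_analytic_on_01I)
  fix a :: real
  have "(\<lambda>n. (if n = 0 then k else 0) * (x - a) ^ n) sums k" for x
    using sums_finite[of "{0}" "\<lambda>n. (if n = 0 then k else 0) * (x - a) ^ n"] by auto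
  then show "\<exists>c r. r > 0 \<and> (\<forall>x\<in>{0..1}. \<bar>x - a\<bar> < r \<longrightarrow>
      (\<lambda>n. c n * (x - a) ^ n) sums (\<lambda>x\<in>{0..1}. k) x)"
    by (intro exI[of _ "\<lambda>n. if n = 0 then k else 0"] exI[of _ 1]) auto
qed

lemma real_analytic_on_01_imp_continuous_on:
  assumes "real_analytic_on f {0..1}"
  shows "continuous_on {0..1} f"
  unfolding continuous_on_eq_continuous_within
proof
  fix a :: real assume a: "a \<in> {0..1}"
  obtain c r where c: "r > 0" "\<And>x. x \<in> {0..1} \<Longrightarrow> \<bar>x - a\<bar> < r \<Longrightarrow> (\<lambda>n. c n * (x - a) ^ n) sums f x"
    "\<And>y. \<bar>y\<bar> < r \<Longrightarrow> summable (\<lambda>n. norm (c n * y ^ n))"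
    by (rule power_series_at_01[OF assms a]) (rule that; assumption)
  have "isCont (\<lambda>y. \<Sum>n. c n * y ^ n) 0"
  proof (rule isCont_powser)
    show "summable (\<lambda>n. c n * (r/2) ^ n)"
      using c(1) by (intro summable_norm_cancel[OF c(3)]) simp
  qed (use c(1) in simp)
  then have "isCont (\<lambda>x. \<Sum>n. c n * (x - a) ^ n) a"
    by (intro isCont_o2[of a "\<lambda>x. x - a" "\<lambda>y. \<Sum>n. c n * y ^ n"]) simp_all
  then have "continuous (at a within {0..1}) (\<lambda>x. \<Sum>n. c n * (x - a) ^ n)"
    by (rule continuous_at_imp_continuous_at_within)
  then show "continuous (at a within {0..1}) f"
    by (rule continuous_transform_within[OF _ c(1) a])
      (simp add: dist_real_def sums_unique[OF c(2), symmetric])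
qed

lemma subcring_C_omega01: "subcring (carrier C_omega01) C01"
proof -
  interpret cring C01 by (rule cring_C01)
  show ?thesis
  proof (intro subcringI' subringI)
    show sub: "carrier C_omega01 \<subseteq> carrier C01"
      by (auto simp: C_omega01_def C01_def real_analytic_on_01_imp_continuous_on)
    fix f assume f: "f \<in> carrier C_omega01"
    define g where "g = (\<lambda>x\<in>{0..1}. (\<lambda>x\<in>{0..1}. -1::real) x * f x)"
    have g: "g \<in> carrier C_omega01"
      using f real_analytic_on_01_mult[OF real_analytic_on_01_const[of "-1"]]
      by (auto simp: C_omega01_def g_def)
    have "g \<oplus>\<^bsub>C01\<^esub> f = \<zero>\<^bsub>C01\<^esub>"
      by (auto simp: C01_def g_def fun_eq_iff)
    then show "\<ominus>\<^bsub>C01\<^esub> f \<in> carrier C_omega01"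
      using f g sub minus_equality by (metis subsetD)
  qed (auto simp: C_omega01_def C01_def real_analytic_on_01_const
      real_analytic_on_01_add real_analytic_on_01_mult)
qed

end

(* Idea: an element of C_omega01 without zeros is a unit, since power series with nonzero constant
   term have convergent inverses; hence every element of a proper ideal vanishes somewhere.  Passing
   to sums of squares, any finitely many elements of a proper ideal have a common zero, and
   compactness of [0,1] yields a common zero of the whole ideal. *)
theory Submission
  imports Defs
begin

lemma C_omega01_simps:
  "f \<in> carrier C_omega01 \<longleftrightarrow> f \<in> extensional {0..1} \<and> real_analytic_on f {0..1}"
  "f \<otimes>\<^bsub>C_omega01\<^esub> g = (\<lambda>x\<in>{0..1}. f x * g x)"
  "f \<oplus>\<^bsub>C_omega01\<^esub> g = (\<lambda>x\<in>{0..1}. f x + g x)"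
  "\<one>\<^bsub>C_omega01\<^esub> = (\<lambda>x\<in>{0..1}. 1)"
  "\<zero>\<^bsub>C_omega01\<^esub> = (\<lambda>x\<in>{0..1}. 0)"
  by (simp_all add: C_omega01_def C01_def)

text \<open>Analytic functions are continuous, so for elements of \<open>C_omega01\<close>
  membership in \<open>M_C01 \<gamma>\<close> only adds vanishing at \<gamma>.\<close>

lemma M_omega_eq: "M_omega \<gamma> = {f \<in> carrier C_omega01. f \<gamma> = 0}"
  by (auto simp: M_omega_def M_C01_def C01_simps C_omega01_simps real_analytic_on_01_imp_continuous_on)

lemma cring_C_omega01: "cring C_omega01"
proof -
  interpret cring C01 by (rule cring_C01)
  have "cring (C01\<lparr>carrier := carrier C_omega01\<rparr>)"
    using subcring_iff[of "carrier C_omega01"] subcring_C_omega01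
      subcringE(1)[OF subcring_C_omega01] by simp
  moreover have "C01\<lparr>carrier := carrier C_omega01\<rparr> = C_omega01"
    by (simp add: C_omega01_def)
  ultimately show ?thesis by simp
qed

text \<open>The expansion of \<open>f\<close> at \<open>a\<close> has constant term
  \<open>f a\<close>, which is nonzero, so it is invertible as a formal power series. The inverse
  series again has positive radius of convergence, and near \<open>a\<close> the two sums multiply
  to 1.\<close>

lemma real_analytic_on_01_inverse:
  assumes "real_analytic_on f {0..1}" and nz: "\<And>x. x \<in> {0..1} \<Longrightarrow> f x \<noteq> 0"
  shows "real_analytic_on (\<lambda>x\<in>{0..1}. inverse (f x)) {0..1}"
proof (rule real_analytic_on_01I)
  fix a :: real assume a: "a \<in> {0..1}"
  obtain c r where c: "r > 0"
    "\<And>x. x \<in> {0..1} \<Longrightarrow> \<bar>x - a\<bar> < r \<Longrightarrow> (\<lambda>n. c n * (x - a) ^ n) sums f x"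
    "\<And>y. \<bar>y\<bar> < r \<Longrightarrow> summable (\<lambda>n. norm (c n * y ^ n))"
    by (rule power_series_at_01[OF assms(1) a]) (rule that; assumption)
  define F where "F = Abs_fps c"
  \<comment> \<open>Summability at every real \<open>y\<close> with 0 < \<open>y\<close> <
    \<open>r\<close> bounds the radius from below, also when \<open>a\<close> is an endpoint and
    \<open>f\<close> is known on one side only.\<close>
  have "fps_conv_radius F \<ge> ereal r"
    unfolding fps_conv_radius_def F_def
    by (rule conv_radius_geI_ex') (use c(3) in \<open>auto intro: summable_norm_cancel\<close>)
  then have radF: "ereal y < fps_conv_radius F" if "y < r" for y
    using that by (meson ereal_less_eq(3) less_ereal.simps(1) order_less_le_trans)
  have evF: "eval_fps F (x - a) = f x" if "x \<in> {0..1}" "\<bar>x - a\<bar> < r" for x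
    using sums_unique[OF c(2)[OF that]] by (simp add: eval_fps_def F_def)
  have F0: "fps_nth F 0 \<noteq> 0"
    using evF[OF a] nz[OF a] c(1) by (simp add: eval_fps_at_0)
  have "fps_conv_radius (inverse F) > 0"
    using F0 radF[OF c(1)] by (intro fps_conv_radius_inverse_pos) (simp_all add: zero_ereal_def)
  \<comment> \<open>The radius may be infinite, so a positive real below it is chosen.\<close>
  then obtain s where s: "s > 0" "ereal s < fps_conv_radius (inverse F)"
    by (metis ereal_dense2 ereal_less(2))
  have "(\<lambda>n. fps_nth (inverse F) n * (x - a) ^ n) sums inverse (f x)"
    if x: "x \<in> {0..1}" "\<bar>x - a\<bar> < min r s" for x
  proof -
    have rad: "ereal (norm (x - a)) < fps_conv_radius F"
      "ereal (norm (x - a)) < fps_conv_radius (inverse F)"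
      using radF[of "norm (x - a)"] x(2) order_less_trans[OF _ s(2), of "ereal (norm (x - a))"]
      by simp_all
    \<comment> \<open>Evaluation is multiplicative only where both series converge, hence the bound
      \<open>min r s\<close>.\<close>
    have "eval_fps (F * inverse F) (x - a) = eval_fps F (x - a) * eval_fps (inverse F) (x - a)"
      using rad by (rule eval_fps_mult)
    then have "f x * eval_fps (inverse F) (x - a) = 1"
      using F0 evF x by (simp add: inverse_mult_eq_1')
    then have "eval_fps (inverse F) (x - a) = inverse (f x)"
      by (simp add: inverse_unique)
    then show ?thesis
      using sums_eval_fps[OF rad(2)] by simp
  qed
  then show "\<exists>c r. r > 0 \<and> (\<forall>x\<in>{0..1}. \<bar>x - a\<bar> < r \<longrightarrow>
      (\<lambda>n. c n * (x - a) ^ n) sums (\<lambda>x\<in>{0..1}. inverse (f x)) x)"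
    using c(1) s(1) by (intro exI[of _ "fps_nth (inverse F)"] exI[of _ "min r s"]) auto
qed

lemma ideal_M_omega:
  assumes "\<gamma> \<in> {0..1}"
  shows "ideal (M_omega \<gamma>) C_omega01"
proof -
  interpret cring C_omega01 by (rule cring_C_omega01)
  show ?thesis
  proof (rule idealI[OF ring_axioms add.subgroupI])
    show "M_omega \<gamma> \<noteq> {}"
      using assms zero_closed by (auto simp: M_omega_eq C_omega01_simps(5) simp del: zero_closed)
    show "\<ominus>\<^bsub>C_omega01\<^esub> f \<in> M_omega \<gamma>" if f: "f \<in> M_omega \<gamma>" for f
    proof -
      have fc: "f \<in> carrier C_omega01" "f \<gamma> = 0"
        using f by (auto simp: M_omega_eq)
      \<comment> \<open>The ring negative is given only abstractly; its value at \<gamma> is read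
        off from the equation that characterizes it.\<close>
      have "(f \<oplus>\<^bsub>C_omega01\<^esub> (\<ominus>\<^bsub>C_omega01\<^esub> f)) \<gamma> = \<zero>\<^bsub>C_omega01\<^esub> \<gamma>"
        by (simp add: r_neg fc)
      then have "(\<ominus>\<^bsub>C_omega01\<^esub> f) \<gamma> = 0"
        using assms fc by (simp add: C_omega01_simps(3,5))
      then show ?thesis
        using a_inv_closed[OF fc(1)] by (simp add: M_omega_eq)
    qed
  next
    fix f g assume fg: "f \<in> M_omega \<gamma>" "g \<in> M_omega \<gamma>"
    then have "f \<oplus>\<^bsub>C_omega01\<^esub> g \<in> carrier C_omega01" by (simp add: M_omega_eq)
    then show "f \<oplus>\<^bsub>C_omega01\<^esub> g \<in> M_omega \<gamma>"
      using assms fg by (simp add: M_omega_eq C_omega01_simps(3))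
  next
    fix f g assume fg: "f \<in> M_omega \<gamma>" "g \<in> carrier C_omega01"
    then have "g \<otimes>\<^bsub>C_omega01\<^esub> f \<in> carrier C_omega01" "f \<otimes>\<^bsub>C_omega01\<^esub> g \<in> carrier C_omega01"
      by (simp_all add: M_omega_eq)
    then show "g \<otimes>\<^bsub>C_omega01\<^esub> f \<in> M_omega \<gamma>" "f \<otimes>\<^bsub>C_omega01\<^esub> g \<in> M_omega \<gamma>"
      using assms fg by (simp_all add: M_omega_eq C_omega01_simps(2))
  qed (auto simp: M_omega_eq)
qed

lemma M_omega_neq_carrier:
  assumes "\<gamma> \<in> {0..1}"
  shows "carrier C_omega01 \<noteq> M_omega \<gamma>"
proof -
  interpret cring C_omega01 by (rule cring_C_omega01)
  have "\<one>\<^bsub>C_omega01\<^esub> \<notin> M_omega \<gamma>"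
    using assms by (simp add: M_omega_eq C_omega01_simps(4))
  then show ?thesis using one_closed by blast
qed

text \<open>Such an \<open>f\<close> is a unit, because its pointwise reciprocal is again
  analytic.\<close>

lemma ideal_C_omega01_nonvanishing_imp_carrier:
  assumes "ideal I C_omega01" "f \<in> I" and nz: "\<And>x. x \<in> {0..1} \<Longrightarrow> f x \<noteq> 0"
  shows "I = carrier C_omega01"
proof -
  interpret ideal I C_omega01 by fact
  let ?g = "\<lambda>x\<in>{0..1}. inverse (f x)"
  have "?g \<in> carrier C_omega01"
    using Icarr[OF assms(2)] real_analytic_on_01_inverse[OF _ nz] by (simp add: C_omega01_simps(1))
  then have "f \<otimes>\<^bsub>C_omega01\<^esub> ?g \<in> I"
    by (rule I_r_closed[OF assms(2)])
  moreover have "f \<otimes>\<^bsub>C_omega01\<^esub> ?g = \<one>\<^bsub>C_omega01\<^esub>"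
    using nz by (auto simp: C_omega01_simps(2,4) fun_eq_iff)
  ultimately show ?thesis using one_imp_carrier by simp
qed

text \<open>Modulo \<open>M_omega \<gamma>\<close> every \<open>f\<close> is congruent to the
  constant \<open>f \<gamma>\<close>. A strictly larger ideal therefore contains a nonzero constant,
  which is a unit.\<close>

lemma maximalideal_M_omega:
  assumes \<gamma>: "\<gamma> \<in> {0..1}"
  shows "maximalideal (M_omega \<gamma>) C_omega01"
proof (rule maximalidealI[OF ideal_M_omega[OF \<gamma>] M_omega_neq_carrier[OF \<gamma>]])
  fix J assume J: "ideal J C_omega01" "M_omega \<gamma> \<subseteq> J" "J \<subseteq> carrier C_omega01"
  interpret J: ideal J C_omega01 by fact
  show "J = M_omega \<gamma> \<or> J = carrier C_omega01"
  proof (cases "J \<subseteq> M_omega \<gamma>")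
    case False
    then obtain f where f: "f \<in> J" "f \<in> carrier C_omega01" "f \<gamma> \<noteq> 0"
      using J(3) by (auto simp: M_omega_eq)
    let ?k = "\<lambda>c::real. \<lambda>x\<in>{0..1::real}. c"
    have k: "?k c \<in> carrier C_omega01" for c
      using real_analytic_on_01_const by (simp add: C_omega01_simps(1))
    \<comment> \<open>This is \<open>f \<gamma>\<close> - \<open>f\<close>, written with the
      constant -1 so that the pointwise rules for sum and product suffice.\<close>
    define h where "h = ?k (f \<gamma>) \<oplus>\<^bsub>C_omega01\<^esub> (?k (-1) \<otimes>\<^bsub>C_omega01\<^esub> f)"
    have "h \<in> carrier C_omega01"
      unfolding h_def using f k by (intro J.add.m_closed J.m_closed)
    moreover have "h \<gamma> = 0"
      using \<gamma> by (simp add: h_def C_omega01_simps(2,3))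
    ultimately have "h \<in> J"
      using J(2) by (auto simp: M_omega_eq)
    then have "h \<oplus>\<^bsub>C_omega01\<^esub> f \<in> J"
      using f(1) by (rule additive_subgroup.a_closed[OF J.is_additive_subgroup])
    moreover have "h \<oplus>\<^bsub>C_omega01\<^esub> f = ?k (f \<gamma>)"
      by (auto simp: h_def C_omega01_simps(2,3) fun_eq_iff)
    ultimately show ?thesis
      using f(3) ideal_C_omega01_nonvanishing_imp_carrier[OF J(1), of "?k (f \<gamma>)"] by simp
  qed (use J(2) in blast)
qed

text \<open>Over the reals a finite sum of squares vanishes exactly where all its terms do, so one
  element of the ideal encodes the common zeros of \<open>A\<close>. The equation is confined to the
  interval because ring elements are \<open>undefined\<close> outside it.\<close>

lemma ideal_C_omega01_sum_squares:
  assumes "ideal I C_omega01" "finite A" "A \<subseteq> I"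
  shows "\<exists>h\<in>I. \<forall>x\<in>{0..1}. h x = (\<Sum>f\<in>A. (f x)\<^sup>2)"
  using assms(2,3)
proof (induction A rule: finite_induct)
  case empty
  interpret ideal I C_omega01 by fact
  show ?case
    using additive_subgroup.zero_closed[OF is_additive_subgroup]
    by (intro bexI[of _ "\<zero>\<^bsub>C_omega01\<^esub>"]) (simp_all add: C_omega01_simps(5))
next
  case (insert f A)
  interpret ideal I C_omega01 by fact
  obtain h where h: "h \<in> I" "\<forall>x\<in>{0..1}. h x = (\<Sum>f\<in>A. (f x)\<^sup>2)"
    using insert by auto
  have "(f \<otimes>\<^bsub>C_omega01\<^esub> f) \<oplus>\<^bsub>C_omega01\<^esub> h \<in> I"
    using h(1) insert.prems
    by (intro additive_subgroup.a_closed[OF is_additive_subgroup] I_r_closed) (auto intro: Icarr)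
  moreover have "\<forall>x\<in>{0..1}. ((f \<otimes>\<^bsub>C_omega01\<^esub> f) \<oplus>\<^bsub>C_omega01\<^esub> h) x = (\<Sum>f\<in>insert f A. (f x)\<^sup>2)"
    using h(2) insert.hyps by (simp add: C_omega01_simps(2,3) power2_eq_square)
  ultimately show ?case by blast
qed

lemma proper_ideal_C_omega01_common_zero:
  assumes I: "ideal I C_omega01" "I \<noteq> carrier C_omega01"
  shows "\<exists>\<gamma>\<in>{0..1}. I \<subseteq> M_omega \<gamma>"
proof -
  interpret ideal I C_omega01 by fact
  define Z where "Z f = {x \<in> {0..1}. f x = 0}" for f :: "real \<Rightarrow> real"
  \<comment> \<open>The finite intersection property on the compact interval reduces the claim to
    finite subsets of \<open>I\<close>.\<close>
  have "{0..1} \<inter> (\<Inter>f\<in>I. Z f) \<noteq> {}"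
  proof (rule compact_imp_fip_image)
    fix f assume "f \<in> I"
    then have "continuous_on {0..1} f"
      using Icarr by (auto simp: C_omega01_simps(1) intro: real_analytic_on_01_imp_continuous_on)
    then show "closed (Z f)"
      unfolding Z_def by (intro continuous_closed_preimage_constant) auto
  next
    fix A assume A: "finite A" "A \<subseteq> I"
    obtain h where h: "h \<in> I" "\<And>x. x \<in> {0..1} \<Longrightarrow> h x = (\<Sum>f\<in>A. (f x)\<^sup>2)"
      using ideal_C_omega01_sum_squares[OF I(1) A] by blast
    \<comment> \<open>Without a zero of \<open>h\<close>, the ideal would be the whole ring.\<close>
    obtain x where x: "x \<in> {0..1}" "h x = 0"
      using ideal_C_omega01_nonvanishing_imp_carrier[OF I(1) h(1)] I(2) by blast
    then have "\<forall>f\<in>A. f x = 0"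
      using h(2)[OF x(1)] A(1) by (simp add: sum_nonneg_eq_0_iff)
    then show "{0..1} \<inter> (\<Inter>f\<in>A. Z f) \<noteq> {}"
      using x(1) by (auto simp: Z_def)
  qed simp
  then show ?thesis
    using Icarr by (fastforce simp: Z_def M_omega_eq)
qed

theorem mainTheorem1:
  shows "(\<forall>\<gamma>\<in>{0..1::real}.
            M_omega \<gamma> = {f \<in> carrier C_omega01. f \<gamma> = 0} \<and>
            maximalideal (M_omega \<gamma>) C_omega01) \<and>
         (\<forall>I. maximalideal I C_omega01 \<longrightarrow> (\<exists>\<gamma>\<in>{0..1}. I = M_omega \<gamma>))"
proof (intro conjI ballI allI impI)
  fix \<gamma> :: real assume "\<gamma> \<in> {0..1}"
  then show "maximalideal (M_omega \<gamma>) C_omega01"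
    by (rule maximalideal_M_omega)
next
  fix I assume "maximalideal I C_omega01"
  then interpret maximalideal I C_omega01 .
  obtain \<gamma> where \<gamma>: "\<gamma> \<in> {0..1}" "I \<subseteq> M_omega \<gamma>"
    using proper_ideal_C_omega01_common_zero[OF is_ideal] I_notcarr by blast
  \<comment> \<open>Maximality of \<open>I\<close> leaves only \<open>I\<close> and the whole ring
    for the ideal \<open>M_omega \<gamma>\<close> above it, and the latter is excluded since the
    constant 1 does not vanish at \<gamma>.\<close>
  then have "I = M_omega \<gamma>"
    using I_maximal[OF ideal_M_omega[OF \<gamma>(1)] \<gamma>(2)] M_omega_neq_carrier[OF \<gamma>(1)]
    by (auto simp: M_omega_eq)
  then show "\<exists>\<gamma>\<in>{0..1}. I = M_omega \<gamma>"
    using \<gamma>(1) by blast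
qed (rule M_omega_eq)

end
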